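(* The problem \[ \min_{\mathbf{x}\in\mathcal{X}} \ \alpha\sum_{j\in[n]} c^I_j x_j + (1-\alpha)\sum_{i\in[N]}\tilde{\lambda}_i\, H\bigl(\chi_{E'}(\mathbf{x}),\chi_{E'}(\mathbf{x}^i)\bigr) \] can be solved in polynomial time, if the nominal problem $\min_{\mathbf{x}\in\mathcal{X}}\sum_{j\in[n]} c_j x_j$ can be solved in polynomial time for arbitrary cost values $c_1,\ldots,c_n$ (of arbitrary sign).
   Context: Notation: $[n]=\{1,\ldots,n\}$. The set of feasible solutions $\mathcal{X}\subseteq\{0,1\}^n$ consists of binary vectors and does not depend on the instance; $\mathcal{X}$ may be given implicitly (e.g. by a graph). For an instance $I$, $c^I_j$ is the cost of item $j\in[n]$. There are $N>0$ historic solutions $\mathbf{x}^1,\ldots,\mathbf{x}^N\in\mathcal{X}$ with weights $\tilde{\lambda}_1,\ldots,\tilde{\lambda}_N\in\mathbb{R}$, which are part of the input and may be positive, zero or negative. The scalarization weight is $\alpha\in(0,1)$. All numerical input data are rational. $E'\subseteq[n]$ is a given set of important elements (possibly $E'=[n]$), and $\chi_{E'}(\mathbf{x})=(x_j)_{j\in E'}\in\{0,1\}^{|E'|}$ indicates for each element of $E'$ whether the solution $\mathbf{x}$ contains it. $H:\{0,1\}^{|E'|}\times\{0,1\}^{|E'|}\to\mathbb{N}$ is the Hamming distance (number of coordinates in which the two vectors differ). *)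

theory Defs
  imports "HOL-Library.Log_Nat" "HOL-Computational_Algebra.Polynomial"
begin

section \<open>Polynomial time\<close>

text \<open>
  The machine model is a structured imperative language with finitely many registers per program.
  Registers hold finite trees of integers, and time is measured by the logarithmic cost criterion:
  evaluating an expression is charged the bit size of the value of every subexpression, so
  neither large integers nor large trees are ever produced or inspected at unit cost.  As for random
  access machines under logarithmic cost, running times are polynomially related to those of
  multi-tape Turing machines.
\<close>

datatype data = Num int | Lst "data list"

primrec num_of :: "data \<Rightarrow> int" where
  "num_of (Num i) = i"
| "num_of (Lst xs) = 0"

primrec list_of :: "data \<Rightarrow> data list" where
  "list_of (Num i) = []"
| "list_of (Lst xs) = xs"

text \<open>Integers are counted in binary; the summand 1 pays for the sign or for the list node.\<close>

primrec dsize :: "data \<Rightarrow> nat" where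
  "dsize (Num i) = 1 + floorlog 2 (nat \<bar>i\<bar>)"
| "dsize (Lst xs) = 1 + sum_list (map dsize xs)"

datatype unop = Head | Tail | IsNum | IsEmpty

datatype binop = Add | Sub | Mult | Div | Less | Push

datatype expr = Var nat | Const data | Unop unop expr | Binop binop expr expr

fun apply_unop :: "unop \<Rightarrow> data \<Rightarrow> data" where
  "apply_unop Head v = (case list_of v of [] \<Rightarrow> Lst [] | x # xs \<Rightarrow> x)"
| "apply_unop Tail v = Lst (tl (list_of v))"
| "apply_unop IsNum v = Num (case v of Num i \<Rightarrow> 1 | Lst xs \<Rightarrow> 0)"
| "apply_unop IsEmpty v = Num (of_bool (v = Lst []))"

fun apply_binop :: "binop \<Rightarrow> data \<Rightarrow> data \<Rightarrow> data" where
  "apply_binop Add v w = Num (num_of v + num_of w)"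
| "apply_binop Sub v w = Num (num_of v - num_of w)"
| "apply_binop Mult v w = Num (num_of v * num_of w)"
| "apply_binop Div v w = Num (num_of v div num_of w)"
| "apply_binop Less v w = Num (of_bool (num_of v < num_of w))"
| "apply_binop Push v w = Lst (v # list_of w)"

type_synonym store = "nat \<Rightarrow> data"

primrec eval_expr :: "store \<Rightarrow> expr \<Rightarrow> data" where
  "eval_expr s (Var x) = s x"
| "eval_expr s (Const v) = v"
| "eval_expr s (Unop f e) = apply_unop f (eval_expr s e)"
| "eval_expr s (Binop f e e') = apply_binop f (eval_expr s e) (eval_expr s e')"

primrec expr_cost :: "store \<Rightarrow> expr \<Rightarrow> nat" where
  "expr_cost s (Var x) = dsize (s x)"
| "expr_cost s (Const v) = dsize v"
| "expr_cost s (Unop f e) = expr_cost s e + dsize (eval_expr s (Unop f e))"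
| "expr_cost s (Binop f e e') =
     expr_cost s e + expr_cost s e' + dsize (eval_expr s (Binop f e e'))"

datatype com = Skip | Assign nat expr | Seq com com | Cond expr com com | While expr com

text \<open>
  \<open>exec c s t s'\<close>: started in store \<open>s\<close>, the command \<open>c\<close> halts in store \<open>s'\<close> after time \<open>t\<close>.
  A test succeeds iff its value is different from \<open>Num 0\<close>.
\<close>

inductive exec :: "com \<Rightarrow> store \<Rightarrow> nat \<Rightarrow> store \<Rightarrow> bool" where
  Skip: "exec Skip s 1 s"
| Assign: "exec (Assign x e) s (1 + expr_cost s e) (s(x := eval_expr s e))"
| Seq: "exec c s t s' \<Longrightarrow> exec c' s' t' s'' \<Longrightarrow> exec (Seq c c') s (t + t') s''"
| Cond_True: "eval_expr s e \<noteq> Num 0 \<Longrightarrow> exec c s t s' \<Longrightarrow>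
    exec (Cond e c c') s (1 + expr_cost s e + t) s'"
| Cond_False: "eval_expr s e = Num 0 \<Longrightarrow> exec c' s t s' \<Longrightarrow>
    exec (Cond e c c') s (1 + expr_cost s e + t) s'"
| While_True: "eval_expr s e \<noteq> Num 0 \<Longrightarrow> exec c s t s' \<Longrightarrow> exec (While e c) s' t' s'' \<Longrightarrow>
    exec (While e c) s (1 + expr_cost s e + t + t') s''"
| While_False: "eval_expr s e = Num 0 \<Longrightarrow> exec (While e c) s (1 + expr_cost s e) s"

inductive_cases SkipE: "exec Skip s t s'"
inductive_cases AssignE: "exec (Assign x e) s t s'"
inductive_cases SeqE: "exec (Seq c c') s t s'"
inductive_cases CondE: "exec (Cond e c c') s t s'"
inductive_cases WhileE: "exec (While e c) s t s'"

lemma exec_deterministic: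
  "exec c s t s' \<Longrightarrow> exec c s u r \<Longrightarrow> u = t \<and> r = s'"
proof (induction arbitrary: u r rule: exec.induct)
  case Skip
  then show ?case by (auto elim: SkipE)
next
  case Assign
  then show ?case by (auto elim: AssignE)
next
  case (Seq c s t s' c' t' s'')
  from Seq.prems obtain t1 s1 t2
    where *: "exec c s t1 s1" "exec c' s1 t2 r" "u = t1 + t2" by (rule SeqE)
  from Seq.IH(1)[OF *(1)] * have "t1 = t" "exec c' s' t2 r" by simp_all
  with Seq.IH(2) *(3) show ?case by simp
next
  case (Cond_True s e c t s' c')
  from Cond_True.prems obtain t1
    where *: "exec c s t1 r" "u = 1 + expr_cost s e + t1" by (rule CondE) (simp_all add: Cond_True.hyps(1))
  from Cond_True.IH[OF *(1)] *(2) show ?case by simp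
next
  case (Cond_False s e c' t s' c)
  from Cond_False.prems obtain t1
    where *: "exec c' s t1 r" "u = 1 + expr_cost s e + t1" by (rule CondE) (simp_all add: Cond_False.hyps(1))
  from Cond_False.IH[OF *(1)] *(2) show ?case by simp
next
  case (While_True s e c t s' t' s'')
  from While_True.prems obtain t1 s1 t2
    where *: "exec c s t1 s1" "exec (While e c) s1 t2 r" "u = 1 + expr_cost s e + t1 + t2"
    by (rule WhileE) (simp_all add: While_True.hyps(1))
  from While_True.IH(1)[OF *(1)] * have "t1 = t" "exec (While e c) s' t2 r" by simp_all
  with While_True.IH(2) *(3) show ?case by simp
next
  case (While_False s e c)
  from While_False.prems show ?case by (rule WhileE) (simp_all add: While_False.hyps)
qed

text \<open>Input and output are both passed in register 0; all other registers start out empty.\<close>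

definition init_store :: "data \<Rightarrow> store" where
  "init_store v = (\<lambda>x. if x = 0 then v else Lst [])"

text \<open>
  A (search or optimization) problem consists of a set \<open>Inst\<close> of instances and of the set \<open>Sol i\<close> of
  acceptable answers to each instance \<open>i\<close>; \<open>enc\<close> and \<open>out\<close> encode instances and answers.
\<close>

definition poly_time_solvable ::
    "('i \<Rightarrow> data) \<Rightarrow> ('o \<Rightarrow> data) \<Rightarrow> 'i set \<Rightarrow> ('i \<Rightarrow> 'o set) \<Rightarrow> bool" where
  "poly_time_solvable enc out Inst Sol \<longleftrightarrow>
     (\<exists>(c :: com) (p :: nat poly). \<forall>i\<in>Inst. \<exists>t s'. \<exists>y\<in>Sol i.
        exec c (init_store (enc i)) t s' \<and> s' 0 = out y \<and> t \<le> poly p (dsize (enc i)))"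


section \<open>The optimization problems\<close>

text \<open>
  Binary vectors are Boolean lists, indexed from 0.  Rationals are
  encoded as reduced fractions with positive denominator.
\<close>

definition enc_rat :: "rat \<Rightarrow> data" where
  "enc_rat r = Lst [Num (fst (quotient_of r)), Num (snd (quotient_of r))]"

definition enc_rats :: "rat list \<Rightarrow> data" where
  "enc_rats rs = Lst (map enc_rat rs)"

definition enc_bits :: "bool list \<Rightarrow> data" where
  "enc_bits x = Lst (map (\<lambda>b. Num (of_bool b)) x)"

definition linear_cost :: "rat list \<Rightarrow> bool list \<Rightarrow> rat" where
  "linear_cost c x = (\<Sum>j<length c. c ! j * of_bool (x ! j))"

text \<open>
  A family of feasible sets maps a description \<open>d\<close> (for example an encoded graph) to a dimension
  \<open>n d\<close> and a set \<open>X d\<close> of binary vectors of that length.  Descriptions with \<open>X d = {}\<close> admit no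
  minimum and are not instances.
\<close>

definition nominal_instances ::
    "(data \<Rightarrow> nat) \<Rightarrow> (data \<Rightarrow> bool list set) \<Rightarrow> (data \<times> rat list) set" where
  "nominal_instances n X = {(d, c). X d \<noteq> {} \<and> length c = n d}"

definition nominal_optima ::
    "(data \<Rightarrow> bool list set) \<Rightarrow> data \<times> rat list \<Rightarrow> bool list set" where
  "nominal_optima X = (\<lambda>(d, c). {x. is_arg_min (linear_cost c) (\<lambda>x. x \<in> X d) x})"

definition enc_nominal :: "data \<times> rat list \<Rightarrow> data" where
  "enc_nominal = (\<lambda>(d, c). Lst [d, enc_rats c])"

definition hamming :: "'a list \<Rightarrow> 'a list \<Rightarrow> nat" where
  "hamming u v = card {k. k < length u \<and> u ! k \<noteq> v ! k}"

record historic_instance =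
  descr :: data
  costs :: "rat list"
  history :: "bool list list"
  weights :: "rat list"
  alpha :: rat
  important :: "nat set"

text \<open>\<open>nths x E\<close> is the subvector of \<open>x\<close> on the positions in \<open>E\<close>.\<close>

definition historic_objective :: "historic_instance \<Rightarrow> bool list \<Rightarrow> rat" where
  "historic_objective I x =
     alpha I * linear_cost (costs I) x
     + (1 - alpha I) * (\<Sum>i<length (history I). weights I ! i *
         of_nat (hamming (nths x (important I)) (nths (history I ! i) (important I))))"

definition historic_instances ::
    "(data \<Rightarrow> nat) \<Rightarrow> (data \<Rightarrow> bool list set) \<Rightarrow> historic_instance set" where
  "historic_instances n X =
     {I. length (costs I) = n (descr I)
       \<and> history I \<noteq> [] \<and> set (history I) \<subseteq> X (descr I)
       \<and> length (weights I) = length (history I)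
       \<and> 0 < alpha I \<and> alpha I < 1
       \<and> important I \<subseteq> {..<n (descr I)}}"

definition historic_optima ::
    "(data \<Rightarrow> bool list set) \<Rightarrow> historic_instance \<Rightarrow> bool list set" where
  "historic_optima X I = {x. is_arg_min (historic_objective I) (\<lambda>x. x \<in> X (descr I)) x}"

text \<open>The set of important elements is encoded by its incidence vector.\<close>

definition enc_historic :: "historic_instance \<Rightarrow> data" where
  "enc_historic I =
     Lst [descr I, enc_rats (costs I), Lst (map enc_bits (history I)), enc_rats (weights I),
       enc_rat (alpha I), enc_bits (map (\<lambda>j. j \<in> important I) [0..<length (costs I)])]"

end

theory Submission
  imports Defs
begin

text \<open>
  For bits \<open>x\<close> and \<open>h\<close> we have \<open>[x \<noteq> h] = h + (1 - 2 h) x\<close>, so each Hamming distance, and hence the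
  whole objective, is an affine function of \<open>x\<close>; its linear part is a nominal cost vector of
  arbitrary sign.  The nominal costs passed to the assumed algorithm are scaled by the denominator of
  \<open>\<alpha>\<close> and the product of all denominators of costs and weights.  They are then integers, which
  spares the reduction the computation of greatest common divisors that reduced fractions would need,
  and their bit size stays linear in the input size.
\<close>

section \<open>Bit sizes\<close>

text \<open>The algebra of the objective is short; the effort lies in running a concrete program
  under logarithmic cost, where every value is charged its size. A single assignment may multiply a
  size bound by a constant, so propagating such bounds through a loop would only give an exponential
  estimate. Each loop therefore comes with a closed form of its store after k rounds, and sizes are
  read off this closed form. All of them lie below one number, \<open>reg_bound\<close>, quadratic
  in the input size, so a round of a simple loop costs a constant multiple of it, and there are at
  most that many rounds. The assumed algorithm is called once, at the end, and is specified only
  from an initial store; the reduction has to leave exactly such a store behind.\<close>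

lemma floorlog_le_bits: "floorlog 2 (nat \<bar>a\<bar>) \<le> k \<longleftrightarrow> \<bar>a\<bar> < 2 ^ k"
  by (simp add: floorlog_le_iff nat_less_iff flip: zless_nat_eq_int_zless)

lemma less_two_power_floorlog: "\<bar>a\<bar> < 2 ^ floorlog 2 (nat \<bar>a\<bar>)"
  using floorlog_le_bits by blast

lemma one_le_dsize: "1 \<le> dsize v"
  by (cases v) auto

lemma dsize_le_of_mem: "x \<in> set xs \<Longrightarrow> dsize x \<le> dsize (Lst xs)"
  by (induction xs) auto

lemma length_le_dsize: "length xs \<le> dsize (Lst xs)"
proof (induction xs)
  case (Cons x xs)
  then show ?case using one_le_dsize[of x] by simp
qed simp

lemma dsize_drop_le: "dsize (Lst (drop k xs)) \<le> dsize (Lst xs)"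
proof (induction xs arbitrary: k)
  case (Cons x xs)
  then show ?case by (cases k) (auto intro: trans_le_add2)
qed simp

lemma dsize_rev: "dsize (Lst (rev xs)) = dsize (Lst xs)"
  by (simp flip: rev_map)

lemma dsize_take_le: "dsize (Lst (take k xs)) \<le> dsize (Lst xs)"
proof (induction xs arbitrary: k)
  case (Cons x xs)
  then show ?case by (cases k) auto
qed simp

lemma dsize_num_of_le: "dsize (Num (num_of v)) \<le> dsize v"
  using one_le_dsize[of v] by (cases v) (auto simp: floorlog_def)

lemma dsize_list_of_le: "dsize (Lst (list_of v)) \<le> dsize v"
  using one_le_dsize[of v] by (cases v) auto

lemma dsize_of_bool_le: "dsize (Num (of_bool b)) \<le> 2"
  using floorlog_le_bits[of "of_bool b" 1] by simp

lemma dsize_apply_unop_le: "dsize (apply_unop f v) \<le> dsize v + 2"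
proof (cases f)
  case Head
  then show ?thesis using dsize_list_of_le[of v] by (cases "list_of v") auto
next
  case Tail
  then show ?thesis using dsize_list_of_le[of v] by (cases "list_of v") auto
next
  case IsNum
  then show ?thesis
    using dsize_of_bool_le[of True] dsize_of_bool_le[of False]
    by (cases v) auto
next
  case IsEmpty
  then show ?thesis using dsize_of_bool_le[of "v = Lst []"] by simp
qed

lemma abs_div_le: "\<bar>a div b\<bar> \<le> \<bar>a\<bar>" for a b :: int
proof (cases "b = 0")
  case False
  have *: "\<bar>a div b\<bar> \<le> \<bar>a\<bar>" if "b > 0" for a b :: int
  proof (cases "0 \<le> a div b")
    case True
    then have "1 * (a div b) \<le> b * (a div b)" using that by (intro mult_right_mono) auto
    then show ?thesis using True that mult_div_mod_eq[of b a] pos_mod_sign[OF that, of a] by linarith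
  next
    case False
    \<comment> \<open>Rounding goes towards minus infinity, which moves a negative quotient away
      from zero. With q = \<open>a div b\<close> < 0, the remainder bound gives a < b (q + 1) \<le>
      q + 1, hence a \<le> q < 0.\<close>
    have "b * (a div b + 1) \<le> 1 * (a div b + 1)"
      using that False by (intro mult_right_mono_neg) auto
    then show ?thesis
      unfolding distrib_left
      using False mult_div_mod_eq[of b a] pos_mod_bound[OF that, of a] by linarith
  qed
  show ?thesis
    using *[of b a] *[of "- b" "- a"] False by (cases "b > 0") auto
qed simp

text \<open>Both summands bring a unit for the sign and the result needs only one; the other pays
  for the carry bit.\<close>

lemma dsize_Num_add_le: "dsize (Num (a + b)) \<le> dsize (Num a) + dsize (Num b)"
proof -
  let ?i = "floorlog 2 (nat \<bar>a\<bar>)" and ?j = "floorlog 2 (nat \<bar>b\<bar>)"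
  have "\<bar>a + b\<bar> < 2 ^ ?i + 2 ^ ?j"
    using less_two_power_floorlog[of a] less_two_power_floorlog[of b] by linarith
  also have "\<dots> \<le> 2 ^ (?i + ?j) + 2 ^ (?i + ?j)"
    by (intro add_mono power_increasing) auto
  finally have "\<bar>a + b\<bar> < 2 ^ (?i + ?j + 1)" by simp
  then have "floorlog 2 (nat \<bar>a + b\<bar>) \<le> ?i + ?j + 1" by (simp only: floorlog_le_bits)
  then show ?thesis by simp
qed

lemma dsize_Num_mult_le: "dsize (Num (a * b)) \<le> dsize (Num a) + dsize (Num b)"
proof -
  let ?i = "floorlog 2 (nat \<bar>a\<bar>)" and ?j = "floorlog 2 (nat \<bar>b\<bar>)"
  have "\<bar>a * b\<bar> < 2 ^ (?i + ?j)"
    using mult_strict_mono'[OF less_two_power_floorlog[of a] less_two_power_floorlog[of b]]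
    by (simp add: abs_mult power_add)
  then have "floorlog 2 (nat \<bar>a * b\<bar>) \<le> ?i + ?j" by (simp only: floorlog_le_bits)
  then show ?thesis by simp
qed

lemma dsize_Num_mono: "\<bar>a\<bar> \<le> \<bar>b\<bar> \<Longrightarrow> dsize (Num a) \<le> dsize (Num b)"
  using less_two_power_floorlog[of b] floorlog_le_bits[of a "floorlog 2 (nat \<bar>b\<bar>)"] by simp

text \<open>Growth is additive for every operation, multiplication included, which is what makes
  expression costs linear in the register sizes. The constant 2 is the size of a truth
  value.\<close>

lemma dsize_apply_binop_le: "dsize (apply_binop f v w) \<le> dsize v + dsize w + 2"
proof (cases f)
  case Add
  then show ?thesis
    using dsize_Num_add_le[of "num_of v" "num_of w"] dsize_num_of_le[of v] dsize_num_of_le[of w]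
    by simp
next
  case Sub
  then show ?thesis
    using dsize_Num_add_le[of "num_of v" "- num_of w"] dsize_num_of_le[of v] dsize_num_of_le[of w]
    by simp
next
  case Mult
  then show ?thesis
    using dsize_Num_mult_le[of "num_of v" "num_of w"] dsize_num_of_le[of v] dsize_num_of_le[of w]
    by simp
next
  case Div
  then show ?thesis
    using dsize_Num_mono[OF abs_div_le[of "num_of v" "num_of w"]] dsize_num_of_le[of v]
    by simp
next
  case Less
  then show ?thesis using dsize_of_bool_le[of "num_of v < num_of w"] by simp
next
  case Push
  then show ?thesis using dsize_list_of_le[of w] by simp
qed


section \<open>Running time of straight-line code and of list loops\<close>

definition fits :: "nat \<Rightarrow> store \<Rightarrow> bool" where
  "fits S s \<longleftrightarrow> (\<forall>x. dsize (s x) \<le> S)"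

text \<open>An expression costs at most its weight times a common bound on the registers. The
  doubling charges each argument twice, once for its own evaluation and once for its share in the
  size of the result.\<close>

primrec weight :: "expr \<Rightarrow> nat" where
  "weight (Var x) = 1"
| "weight (Const v) = dsize v"
| "weight (Unop f e) = 2 * weight e + 2"
| "weight (Binop f e e') = 2 * (weight e + weight e') + 2"

lemma one_le_weight: "1 \<le> weight e"
  by (cases e) (auto simp: one_le_dsize[simplified])

lemma fits_pos: "fits S s \<Longrightarrow> 1 \<le> S"
  unfolding fits_def using one_le_dsize le_trans by blast

lemma dsize_eval_le_cost: "dsize (eval_expr s e) \<le> expr_cost s e"
  by (cases e) auto

lemma expr_cost_le: "fits S s \<Longrightarrow> expr_cost s e \<le> weight e * S"
proof (induction e)
  case (Var x)
  then show ?case by (simp add: fits_def)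
next
  case (Const v)
  then show ?case using mult_le_mono[OF le_refl fits_pos, of S s "dsize v"] by simp
next
  case (Unop f e)
  have "expr_cost s (Unop f e) \<le> 2 * expr_cost s e + 2"
    using dsize_apply_unop_le[of f "eval_expr s e"] dsize_eval_le_cost[of s e] by simp
  also have "\<dots> \<le> 2 * (weight e * S) + 2 * S"
    using Unop fits_pos[OF Unop.prems] by simp
  finally show ?case by (simp add: algebra_simps)
next
  case (Binop f e e')
  have "expr_cost s (Binop f e e') \<le> 2 * (expr_cost s e + expr_cost s e') + 2"
    using dsize_apply_binop_le[of f "eval_expr s e" "eval_expr s e'"]
      dsize_eval_le_cost[of s e] dsize_eval_le_cost[of s e'] by simp
  also have "\<dots> \<le> 2 * (weight e * S + weight e' * S) + 2 * S"
    using Binop fits_pos[OF Binop.prems] by (intro add_mono mult_le_mono) auto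
  finally show ?case by (simp add: algebra_simps)
qed

definition runs :: "com \<Rightarrow> store \<Rightarrow> nat \<Rightarrow> store \<Rightarrow> bool" where
  "runs c s T s' \<longleftrightarrow> (\<exists>t\<le>T. exec c s t s')"

lemma runs_Seq: "runs c s T s' \<Longrightarrow> runs c' s' T' s'' \<Longrightarrow> runs (Seq c c') s (T + T') s''"
  unfolding runs_def by (meson add_mono exec.Seq)

primrec assigns :: "(nat \<times> expr) list \<Rightarrow> com" where
  "assigns [] = Skip"
| "assigns (a # as) = Seq (Assign (fst a) (snd a)) (assigns as)"

primrec assigned :: "(nat \<times> expr) list \<Rightarrow> store \<Rightarrow> store" where
  "assigned [] s = s"
| "assigned (a # as) s = assigned as (s(fst a := eval_expr s (snd a)))"

text \<open>After an assignment the registers are only known to fit the bound inflated by its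
  weight, so the rest of the block is measured against that and weights multiply. For a fixed block
  the load is still a constant.\<close>

primrec load :: "(nat \<times> expr) list \<Rightarrow> nat" where
  "load [] = 1"
| "load (a # as) = 1 + weight (snd a) * (1 + load as)"

lemma runs_assigns: "fits S s \<Longrightarrow> runs (assigns as) s (load as * S) (assigned as s)"
proof (induction as arbitrary: s S)
  case Nil
  then show ?case using fits_pos exec.Skip by (fastforce simp: runs_def)
next
  case (Cons a as)
  let ?s = "s(fst a := eval_expr s (snd a))" and ?w = "weight (snd a)"
  have "S \<le> ?w * S" using one_le_weight[of "snd a"] by simp
  then have "fits (?w * S) ?s"
    using Cons.prems expr_cost_le[OF Cons.prems, of "snd a"] dsize_eval_le_cost[of s "snd a"]
    by (auto simp: fits_def intro: le_trans)
  then have "runs (assigns as) ?s (load as * (?w * S)) (assigned as ?s)"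
    by (rule Cons.IH)
  moreover have "runs (Assign (fst a) (snd a)) s (S + ?w * S) ?s"
    unfolding runs_def
    using exec.Assign expr_cost_le[OF Cons.prems, of "snd a"] fits_pos[OF Cons.prems] add_mono
    by metis
  ultimately show ?case
    by (auto dest: runs_Seq simp: algebra_simps)
qed

text \<open>There is no negation among the operations; comparing the truth value of
  \<open>IsEmpty\<close> with 1 negates it.\<close>

definition while_list :: "nat \<Rightarrow> com \<Rightarrow> com" where
  "while_list r c = While (Binop Less (Unop IsEmpty (Var r)) (Const (Num 1))) c"

text \<open>A list has at most as many entries as its size, which gives at most S rounds and one
  last failing test. The test has weight 14, so \<open>20 * S\<close> generously covers it with its
  overhead.\<close>

definition loop_time :: "nat \<Rightarrow> nat \<Rightarrow> nat" where
  "loop_time S T = (S + 1) * (20 * S + T)"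

text \<open>The sequence \<open>\<sigma>\<close> is the invariant in functional form:
  \<open>\<sigma> k\<close> is the exact store after k rounds. Sizes are a hypothesis on every
  \<open>\<sigma> k\<close> and are not inferred from the preceding round, so nothing
  accumulates.\<close>

lemma runs_while_list:
  assumes fits: "\<And>k. k \<le> length xs \<Longrightarrow> fits S (\<sigma> k)"
    and r: "\<And>k. k \<le> length xs \<Longrightarrow> \<sigma> k r = Lst (drop k xs)"
    and body: "\<And>k. k < length xs \<Longrightarrow> runs c (\<sigma> k) T (\<sigma> (Suc k))"
  shows "runs (while_list r c) (\<sigma> 0) (loop_time S T) (\<sigma> (length xs))"
proof -
  let ?e = "Binop Less (Unop IsEmpty (Var r)) (Const (Num 1))"
  have cost: "1 + expr_cost (\<sigma> k) ?e \<le> 20 * S" if "k \<le> length xs" for k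
  proof -
    have "weight ?e = 14" by (simp add: floorlog_def)
    then show ?thesis using expr_cost_le[OF fits[OF that], of ?e] fits_pos[OF fits[OF that]] by simp
  qed
  have "runs (while_list r c) (\<sigma> k) ((length xs - k + 1) * (20 * S + T)) (\<sigma> (length xs))"
    if "k \<le> length xs" for k
    using that
  proof (induction k rule: inc_induct)
    case base
    have "eval_expr (\<sigma> (length xs)) ?e = Num 0" by (simp add: r)
    from exec.While_False[OF this, of c] cost[of "length xs"] show ?case
      unfolding runs_def while_list_def by (intro exI conjI) auto
  next
    case (step k)
    have true: "eval_expr (\<sigma> k) ?e \<noteq> Num 0" using step by (simp add: r)
    obtain t where t: "t \<le> T" "exec c (\<sigma> k) t (\<sigma> (Suc k))"
      using body step unfolding runs_def by blast
    obtain u where u: "u \<le> (length xs - Suc k + 1) * (20 * S + T)"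
      "exec (While ?e c) (\<sigma> (Suc k)) u (\<sigma> (length xs))"
      using step.IH unfolding runs_def while_list_def by blast
    have "length xs - k + 1 = Suc (length xs - Suc k + 1)" using step by simp
    then have "1 + expr_cost (\<sigma> k) ?e + t + u \<le> (length xs - k + 1) * (20 * S + T)"
      using cost[of k] t u step by simp
    then show ?case
      using exec.While_True[OF true t(2) u(2)] unfolding runs_def while_list_def by blast
  qed
  from this[of 0] obtain t where
    "t \<le> (length xs + 1) * (20 * S + T)" "exec (while_list r c) (\<sigma> 0) t (\<sigma> (length xs))"
    unfolding runs_def by auto
  moreover have "length xs \<le> S"
    using fits[of 0] r[of 0] length_le_dsize[of xs] by (auto simp: fits_def intro: le_trans dest: spec[of _ r])
  then have "(length xs + 1) * (20 * S + T) \<le> loop_time S T"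
    unfolding loop_time_def by (intro mult_le_mono) auto
  ultimately show ?thesis unfolding runs_def by (blast intro: le_trans)
qed

section \<open>Stores as finite lists of registers\<close>

definition st :: "data list \<Rightarrow> store" where
  "st vs = (\<lambda>x. if x < length vs then vs ! x else Lst [])"

lemma st_apply: "x < length vs \<Longrightarrow> st vs x = vs ! x"
  by (simp add: st_def)

lemma st_update: "x < length vs \<Longrightarrow> (st vs)(x := v) = st (vs[x := v])"
  by (auto simp: st_def fun_eq_iff)

lemma fits_st: "vs \<noteq> [] \<Longrightarrow> \<forall>v\<in>set vs. dsize v \<le> S \<Longrightarrow> fits S (st vs)"
  using one_le_dsize[of "hd vs"] by (cases vs) (auto simp: fits_def st_def nth_Cons split: nat.split)

text \<open>Trailing empty registers are invisible, so the same store can be shown with one register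
  for size bounds or with all twelve for symbolic execution.\<close>

lemma init_store_eq_st: "init_store v = st (v # replicate m (Lst []))"
  by (auto simp: init_store_def st_def fun_eq_iff nth_Cons split: nat.split)


section \<open>Clearing denominators\<close>

abbreviation num :: "rat \<Rightarrow> int" where "num r \<equiv> fst (quotient_of r)"
abbreviation den :: "rat \<Rightarrow> int" where "den r \<equiv> snd (quotient_of r)"

definition common_den :: "rat list \<Rightarrow> int" where
  "common_den rs = prod_list (map den rs)"

lemma common_den_simps [simp]:
  "common_den [] = 1" "common_den (r # rs) = den r * common_den rs"
  by (simp_all add: common_den_def)

lemma one_le_den: "1 \<le> den r"
  using quotient_of_denom_pos'[of r] by simp

lemma of_int_num: "rat_of_int (num r) = of_int (den r) * r"
  using quotient_of_div[of r "num r" "den r"] one_le_den[of r] by (simp add: divide_simps mult.commute)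

lemma one_le_common_den: "1 \<le> common_den rs"
proof (induction rs)
  case (Cons r rs)
  then show ?case using mult_mono[OF one_le_den[of r] Cons.IH] one_le_den[of r] by simp
qed simp

lemma common_den_append: "common_den (rs @ rs') = common_den rs * common_den rs'"
  by (simp add: common_den_def)

lemma den_dvd_common_den: "r \<in> set rs \<Longrightarrow> den r dvd common_den rs"
  by (induction rs) auto

lemma common_den_take_le: "common_den (take k rs) \<le> common_den rs"
  using mult_left_mono[OF one_le_common_den[of "drop k rs"], of "common_den (take k rs)"]
    one_le_common_den[of "take k rs"]
  by (simp flip: common_den_append)

text \<open>The product is formed before dividing. As \<open>den r\<close> divides D, the integer
  division is exact and no rounding enters the costs.\<close>

lemma num_scaled_div_den:
  assumes "den r dvd D"
  shows "rat_of_int (num r * D div den r) = of_int D * r"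
proof -
  from assms obtain e where "D = den r * e" by (rule dvdE)
  with of_int_num[of r] one_le_den[of r] show ?thesis by simp
qed

text \<open>Bits of factors add up under multiplication, just as sizes of entries add up in a list;
  the product of all denominators is thus no longer than the list that contains them.\<close>

lemma common_den_bound: "common_den rs < 2 ^ dsize (enc_rats rs)"
proof (induction rs)
  case (Cons r rs)
  have "\<bar>den r\<bar> < 2 ^ dsize (enc_rat r)"
    unfolding floorlog_le_bits[symmetric] by (simp add: enc_rat_def)
  then have "den r * common_den rs < 2 ^ dsize (enc_rat r) * 2 ^ dsize (enc_rats rs)"
    using Cons one_le_den[of r] one_le_common_den[of rs] by (intro mult_strict_mono) auto
  then show ?case by (simp add: enc_rats_def power_add algebra_simps)
qed (simp add: enc_rats_def)


section \<open>The reduced cost vector\<close>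

lemma card_Suc_shift:
  "card {k. k < Suc m \<and> P k} = of_bool (P 0) + card {k. k < m \<and> P (Suc k)}"
proof -
  have "{k. k < Suc m \<and> P k} = (if P 0 then {0} else {}) \<union> Suc ` {k. k < m \<and> P (Suc k)}"
    by (auto simp: image_iff less_Suc_eq_0_disj)
  moreover have "card (Suc ` {k. k < m \<and> P (Suc k)}) = card {k. k < m \<and> P (Suc k)}"
    by (rule card_image) simp
  ultimately show ?thesis by (auto simp: card_insert_if)
qed

lemma hamming_Cons: "hamming (a # u) (b # v) = of_bool (a \<noteq> b) + hamming u v"
  unfolding hamming_def by (simp add: card_Suc_shift)

text \<open>\<open>nths\<close> renumbers the selected positions. Induction on the vectors, with E
  generalized because it is shifted down at each step, avoids describing that renumbering.\<close>

lemma hamming_nths: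
  "length x = length h \<Longrightarrow>
    hamming (nths x E) (nths h E) = (\<Sum>j<length x. of_bool (j \<in> E \<and> x ! j \<noteq> h ! j))"
proof (induction x h arbitrary: E rule: list_induct2)
  case Nil
  then show ?case by (simp add: hamming_def)
next
  case (Cons a x b h)
  have "(\<Sum>j<length (a # x). of_bool (j \<in> E \<and> (a # x) ! j \<noteq> (b # h) ! j) :: nat) =
      of_bool (0 \<in> E \<and> a \<noteq> b) + (\<Sum>j<length x. of_bool (Suc j \<in> E \<and> x ! j \<noteq> h ! j))"
    by (simp only: length_Cons sum.lessThan_Suc_shift) simp
  with Cons show ?case by (auto simp: nths_Cons hamming_Cons)
qed

definition scale :: "historic_instance \<Rightarrow> int" where
  "scale I = common_den (costs I) * common_den (weights I)"

text \<open>The numerator of \<alpha> is its denominator times \<alpha>, so this is the exact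
  \<alpha>-part of the cost, scaled by \<open>den (alpha I) * scale I\<close>. In the same way
  \<open>den - num\<close> below stands for 1 - \<alpha>.\<close>

definition base_cost :: "historic_instance \<Rightarrow> nat \<Rightarrow> int" where
  "base_cost I j = num (alpha I) * (num (costs I ! j) * scale I div den (costs I ! j))"

definition scaled_weight :: "historic_instance \<Rightarrow> nat \<Rightarrow> int" where
  "scaled_weight I i =
     (den (alpha I) - num (alpha I)) * (num (weights I ! i) * scale I div den (weights I ! i))"

definition sign_at :: "historic_instance \<Rightarrow> nat \<Rightarrow> nat \<Rightarrow> int" where
  "sign_at I i j = of_bool (j \<in> important I) * (1 - 2 * of_bool (history I ! i ! j))"

text \<open>The index k matches the rounds of the outer program loop, so the invariant of that loop
  is this vector.\<close>

definition partial_cost :: "historic_instance \<Rightarrow> nat \<Rightarrow> nat \<Rightarrow> int" where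
  "partial_cost I k j = base_cost I j + (\<Sum>i<k. scaled_weight I i * sign_at I i j)"

definition reduced_costs :: "historic_instance \<Rightarrow> nat \<Rightarrow> rat list" where
  "reduced_costs I k = map (\<lambda>j. of_int (partial_cost I k j)) [0..<length (costs I)]"

locale historic =
  fixes I :: historic_instance
  assumes length_weights: "length (weights I) = length (history I)"
    and length_history: "\<And>h. h \<in> set (history I) \<Longrightarrow> length h = length (costs I)"
    and alpha: "0 < alpha I" "alpha I < 1"
begin

abbreviation "bits \<equiv> dsize (enc_historic I)"

lemma num_alpha: "0 < num (alpha I)" "num (alpha I) < den (alpha I)"
proof -
  have d: "0 < rat_of_int (den (alpha I))" using one_le_den[of "alpha I"] by simp
  have "0 < rat_of_int (num (alpha I))"
    using d alpha(1) by (simp only: of_int_num mult_pos_pos)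
  then show "0 < num (alpha I)" by simp
  have "rat_of_int (num (alpha I)) < of_int (den (alpha I))"
    using mult_strict_left_mono[OF alpha(2) d] by (simp add: of_int_num)
  then show "num (alpha I) < den (alpha I)" by simp
qed

lemma scale_pos: "0 < scale I"
  using one_le_common_den[of "costs I"] one_le_common_den[of "weights I"]
  unfolding scale_def by (intro mult_pos_pos) auto

lemma of_int_base_cost:
  assumes "j < length (costs I)"
  shows "rat_of_int (base_cost I j) = of_int (den (alpha I) * scale I) * (alpha I * costs I ! j)"
proof -
  have "den (costs I ! j) dvd scale I"
    using assms den_dvd_common_den by (simp add: scale_def)
  then have "rat_of_int (base_cost I j) =
      of_int (den (alpha I)) * alpha I * (of_int (scale I) * costs I ! j)"
    by (simp only: base_cost_def of_int_mult num_scaled_div_den of_int_num)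
  then show ?thesis by (simp add: mult_ac)
qed

lemma of_int_scaled_weight:
  assumes "i < length (history I)"
  shows "rat_of_int (scaled_weight I i) =
    of_int (den (alpha I) * scale I) * ((1 - alpha I) * weights I ! i)"
proof -
  have "den (weights I ! i) dvd scale I"
    using assms den_dvd_common_den length_weights by (simp add: scale_def)
  moreover have "rat_of_int (den (alpha I) - num (alpha I)) = of_int (den (alpha I)) * (1 - alpha I)"
    by (simp add: of_int_num algebra_simps)
  ultimately have "rat_of_int (scaled_weight I i) =
      of_int (den (alpha I)) * (1 - alpha I) * (of_int (scale I) * weights I ! i)"
    by (simp only: scaled_weight_def of_int_mult num_scaled_div_den)
  then show ?thesis by (simp add: mult_ac)
qed

text \<open>The first sum is the distance of the historic solution from the zero vector on the
  important elements; it is independent of x.\<close>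

lemma hamming_eq_signs:
  assumes "length x = length (costs I)" and "i < length (history I)"
  shows "rat_of_nat (hamming (nths x (important I)) (nths (history I ! i) (important I))) =
    (\<Sum>j<length (costs I). of_bool (j \<in> important I \<and> history I ! i ! j)) +
    (\<Sum>j<length (costs I). of_int (sign_at I i j) * of_bool (x ! j))"
proof -
  have "length x = length (history I ! i)" using assms length_history by simp
  then have "rat_of_nat (hamming (nths x (important I)) (nths (history I ! i) (important I))) =
      (\<Sum>j<length (costs I). of_nat (of_bool (j \<in> important I \<and> x ! j \<noteq> history I ! i ! j)))"
    using assms by (simp only: hamming_nths of_nat_sum)
  also have "\<dots> = (\<Sum>j<length (costs I). of_bool (j \<in> important I \<and> history I ! i ! j) +
      of_int (sign_at I i j) * of_bool (x ! j))"
    by (rule sum.cong) (simp_all add: sign_at_def)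
  finally show ?thesis by (simp only: sum.distrib)
qed

text \<open>The subtracted term is the historic objective at the zero vector, feasible or not. The
  identity reads D (f(x) - f(0)) with D = \<open>den (alpha I) * scale I\<close>.\<close>

lemma linear_cost_reduced:
  assumes "length x = length (costs I)"
  shows "linear_cost (reduced_costs I (length (history I))) x =
    of_int (den (alpha I) * scale I) * (historic_objective I x -
      (1 - alpha I) * (\<Sum>i<length (history I). weights I ! i *
        (\<Sum>j<length (costs I). of_bool (j \<in> important I \<and> history I ! i ! j))))"
proof -
  let ?n = "length (costs I)" and ?N = "length (history I)"
  let ?c = "rat_of_int (den (alpha I) * scale I)"
  let ?b = "\<lambda>j. of_bool (x ! j) :: rat" and ?s = "\<lambda>i j. rat_of_int (sign_at I i j)"
  have "linear_cost (reduced_costs I ?N) x =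
      (\<Sum>j<?n. ?c * (alpha I * (costs I ! j * ?b j)) +
        (\<Sum>i<?N. ?c * ((1 - alpha I) * (weights I ! i * (?s i j * ?b j)))))"
    unfolding linear_cost_def
  proof (rule sum.cong)
    fix j assume "j \<in> {..<?n}"
    then have j: "j < ?n" by simp
    have "rat_of_int (\<Sum>i<?N. scaled_weight I i * sign_at I i j) =
        (\<Sum>i<?N. ?c * ((1 - alpha I) * weights I ! i) * ?s i j)"
      unfolding of_int_sum
    proof (rule sum.cong)
      fix i assume "i \<in> {..<?N}"
      then have "rat_of_int (scaled_weight I i) = ?c * ((1 - alpha I) * weights I ! i)"
        using of_int_scaled_weight by simp
      then show "rat_of_int (scaled_weight I i * sign_at I i j) =
          ?c * ((1 - alpha I) * weights I ! i) * ?s i j"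
        by (simp only: of_int_mult[of "scaled_weight I i"])
    qed simp
    then have "reduced_costs I ?N ! j = ?c * (alpha I * costs I ! j) +
        (\<Sum>i<?N. ?c * ((1 - alpha I) * weights I ! i) * ?s i j)"
      using j of_int_base_cost[OF j] by (simp add: reduced_costs_def partial_cost_def)
    then show "reduced_costs I ?N ! j * ?b j = ?c * (alpha I * (costs I ! j * ?b j)) +
        (\<Sum>i<?N. ?c * ((1 - alpha I) * (weights I ! i * (?s i j * ?b j))))"
      by (simp only: distrib_right sum_distrib_right mult.assoc)
  qed (simp add: reduced_costs_def)
  also have "\<dots> = ?c * (alpha I * linear_cost (costs I) x) +
      (\<Sum>i<?N. \<Sum>j<?n. ?c * ((1 - alpha I) * (weights I ! i * (?s i j * ?b j))))"
    by (simp only: sum.distrib linear_cost_def sum_distrib_left) (subst sum.swap, rule refl)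
  also have "\<dots> = ?c * (alpha I * linear_cost (costs I) x +
      (1 - alpha I) * (\<Sum>i<?N. weights I ! i * (\<Sum>j<?n. ?s i j * ?b j)))"
    by (simp only: distrib_left sum_distrib_left)
  finally show ?thesis
    by (simp add: historic_objective_def hamming_eq_signs[OF assms] distrib_left sum.distrib
        algebra_simps)
qed

lemma is_arg_min_reduced:
  assumes len: "\<And>x. x \<in> X \<Longrightarrow> length x = length (costs I)"
    and min: "is_arg_min (linear_cost (reduced_costs I (length (history I)))) (\<lambda>x. x \<in> X) x"
  shows "is_arg_min (historic_objective I) (\<lambda>x. x \<in> X) x"
proof -
  \<comment> \<open>The witness a is the scaling factor shown positive below; b is found by
    unification with \<open>linear_cost_reduced\<close>, which also certifies that it is independent
    of x.\<close>
  obtain a b :: rat where "0 < a" and affine: "\<And>x. x \<in> X \<Longrightarrow>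
      linear_cost (reduced_costs I (length (history I))) x = a * (historic_objective I x - b)"
  proof
    show "0 < rat_of_int (den (alpha I) * scale I)"
      using scale_pos one_le_den[of "alpha I"] by simp
  qed (rule linear_cost_reduced[OF len])
  then have "historic_objective I x \<le> historic_objective I y" if "y \<in> X" for y
    using min that by (auto simp: is_arg_min_linorder mult_le_cancel_left_pos)
  with min show ?thesis by (simp add: is_arg_min_linorder)
qed

end


section \<open>The reduction program\<close>

text \<open>Loop invariants hold the unread part of a list as \<open>drop k xs\<close>. Evaluating
  heads and tails only by these rules keeps symbolic execution in that shape.\<close>

lemma Head_simps [simp]:
  "apply_unop Head (Lst (x # xs)) = x"
  "k < length xs \<Longrightarrow> apply_unop Head (Lst (drop k xs)) = xs ! k"
  by (auto simp: Cons_nth_drop_Suc[symmetric])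

lemma Tail_simps [simp]:
  "apply_unop Tail (Lst (x # xs)) = Lst xs"
  "apply_unop Tail (Lst (drop k xs)) = Lst (drop (Suc k) xs)"
  by (simp_all add: drop_Suc tl_drop)

declare apply_unop.simps(1,2) [simp del]

text \<open>Lists grow only at the front, so the output of a loop is a reversed prefix; this is the
  effect of one \<open>Push\<close>.\<close>

lemma rev_take_Suc: "k < length xs \<Longrightarrow> rev (take (Suc k) xs) = xs ! k # rev (take k xs)"
  by (simp add: take_Suc_conv_app_nth)

lemma dsize_part_le:
  assumes "dsize (Lst xs) \<le> S"
  shows "dsize (Lst (drop k xs)) \<le> S" "dsize (Lst (take k xs)) \<le> S"
    "dsize (Lst (rev xs)) \<le> S" "dsize (Lst (rev (take k xs))) \<le> S"
  using assms dsize_drop_le[of k xs] dsize_take_le[of k xs] dsize_rev[of xs] dsize_rev[of "take k xs"]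
  by linarith+

abbreviation (input) "head e \<equiv> Unop Head e"
abbreviation (input) "tail e \<equiv> Unop Tail e"

text \<open>
  Registers: 1 description, 2 costs, 3 history, 4 weights, 5 \<open>\<alpha>\<close>, 6 incidence vector,
  7 common denominator, 8 current cost vector, 9 its reversal under construction,
  10 and 11 list pointers.
\<close>

definition load_input :: "(nat \<times> expr) list" where
  "load_input =
    [(1, head (Var 0)), (0, tail (Var 0)), (2, head (Var 0)), (0, tail (Var 0)),
     (3, head (Var 0)), (0, tail (Var 0)), (4, head (Var 0)), (0, tail (Var 0)),
     (5, head (Var 0)), (0, tail (Var 0)), (6, head (Var 0)), (0, Const (Lst [])),
     (7, Const (Num 1)), (10, Var 2)]"

definition scale_body :: "(nat \<times> expr) list" where
  "scale_body = [(7, Binop Mult (Var 7) (head (tail (head (Var 10))))), (10, tail (Var 10))]"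

definition scale_of :: "expr \<Rightarrow> expr" where
  "scale_of e = Binop Div (Binop Mult (head e) (Var 7)) (head (tail e))"

text \<open>The constant \<open>Lst [Num 1]\<close> supplies the denominator: [z, 1] is the reduced
  fraction of the integer z.\<close>

definition base_body :: "(nat \<times> expr) list" where
  "base_body =
    [(9, Binop Push (Binop Push (Binop Mult (head (Var 5)) (scale_of (head (Var 2))))
        (Const (Lst [Num 1]))) (Var 9)),
     (2, tail (Var 2))]"

definition reverse_body :: "(nat \<times> expr) list" where
  "reverse_body = [(8, Binop Push (head (Var 9)) (Var 8)), (9, tail (Var 9))]"

definition update_body :: "(nat \<times> expr) list" where
  "update_body =
    [(9, Binop Push (Binop Push
        (Binop Add (head (head (Var 8)))
          (Binop Mult (Binop Mult (Binop Sub (head (tail (Var 5))) (head (Var 5)))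
              (scale_of (head (Var 4))))
            (Binop Mult (head (Var 11))
              (Binop Sub (Const (Num 1)) (Binop Mult (Const (Num 2)) (head (Var 10)))))))
        (Const (Lst [Num 1]))) (Var 9)),
     (8, tail (Var 8)), (10, tail (Var 10)), (11, tail (Var 11))]"

definition prepare_update :: "(nat \<times> expr) list" where
  "prepare_update = [(10, head (Var 3)), (11, Var 6)]"

definition finish_update :: "(nat \<times> expr) list" where
  "finish_update = [(3, tail (Var 3)), (4, tail (Var 4))]"

text \<open>Scratch registers are wiped because the nominal algorithm may rely on finding them
  empty.\<close>

definition store_output :: "(nat \<times> expr) list" where
  "store_output = (0, Binop Push (Var 1) (Binop Push (Var 8) (Const (Lst [])))) #
    map (\<lambda>r. (r, Const (Lst []))) [1..<12]"

definition loop :: "nat \<Rightarrow> (nat \<times> expr) list \<Rightarrow> com" where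
  "loop r b = while_list r (assigns b)"

definition update_com :: com where
  "update_com = Seq (assigns prepare_update) (Seq (loop 8 update_body)
     (Seq (loop 9 reverse_body) (assigns finish_update)))"

definition reduction :: com where
  "reduction = Seq (assigns load_input) (Seq (loop 10 scale_body)
     (Seq (assigns [(10, Var 4)]) (Seq (loop 10 scale_body)
     (Seq (loop 2 base_body) (Seq (loop 9 reverse_body)
     (Seq (while_list 3 update_com) (assigns store_output)))))))"

text \<open>The sum is bracketed like the nested \<open>Seq\<close>, so that \<open>runs_Seq\<close>
  decomposes command and time together.\<close>

definition update_time :: "nat \<Rightarrow> nat" where
  "update_time S = load prepare_update * S + (loop_time S (load update_body * S) +
     (loop_time S (load reverse_body * S) + load finish_update * S))"

definition reduction_time :: "nat \<Rightarrow> nat" where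
  "reduction_time S = load load_input * S + (loop_time S (load scale_body * S) +
     (load [(10, Var 4)] * S + (loop_time S (load scale_body * S) +
     (loop_time S (load base_body * S) + (loop_time S (load reverse_body * S) +
     (loop_time S (update_time S) + load store_output * S))))))"

section \<open>Loops with closed-form invariants\<close>

lemma runs_loop:
  assumes "\<And>k. k \<le> length xs \<Longrightarrow> fits S (\<sigma> k)"
    and "\<And>k. k \<le> length xs \<Longrightarrow> \<sigma> k r = Lst (drop k xs)"
    and "\<And>k. k < length xs \<Longrightarrow> assigned b (\<sigma> k) = \<sigma> (Suc k)"
    and "s = \<sigma> 0" "s' = \<sigma> (length xs)"
  shows "runs (loop r b) s (loop_time S (load b * S)) s'"
  unfolding loop_def assms(4,5)
proof (rule runs_while_list[where xs = xs])
  fix k assume "k < length xs"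
  then show "runs (assigns b) (\<sigma> k) (load b * S) (\<sigma> (Suc k))"
    using assms(1,3)[of k] runs_assigns[of S "\<sigma> k" b] by simp
qed (fact assms)+

lemma runs_assigns': "fits S s \<Longrightarrow> assigned as s = s' \<Longrightarrow> runs (assigns as) s (load as * S) s'"
  using runs_assigns by blast

text \<open>The loop runs twice, from a = 1 over the costs and then from their common denominator
  over the weights. All factors are at least 1, so the partial products increase and a bound on the
  last one covers them all.\<close>

lemma runs_scale:
  assumes a: "1 \<le> a" and S: "dsize (Num (a * common_den rs)) \<le> S" "dsize (enc_rats rs) \<le> S"
    and vs: "\<forall>v\<in>{v0,v1,v2,v3,v4,v5,v6,v8,v9,v11}. dsize v \<le> S"
  shows "runs (loop 10 scale_body)
    (st [v0,v1,v2,v3,v4,v5,v6,Num a,v8,v9,enc_rats rs,v11]) (loop_time S (load scale_body * S))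
    (st [v0,v1,v2,v3,v4,v5,v6,Num (a * common_den rs),v8,v9,Lst [],v11])"
proof (rule runs_loop[where xs = "map enc_rat rs" and \<sigma> = "\<lambda>k.
    st [v0,v1,v2,v3,v4,v5,v6,Num (a * common_den (take k rs)),v8,v9,Lst (drop k (map enc_rat rs)),v11]"])
  fix k
  have "a * common_den (take k rs) \<le> a * common_den rs"
    using a common_den_take_le by (intro mult_left_mono) auto
  moreover have "0 \<le> a * common_den (take k rs)"
    using a one_le_common_den[of "take k rs"] by simp
  ultimately have "dsize (Num (a * common_den (take k rs))) \<le> S"
    using S(1) dsize_Num_mono[of "a * common_den (take k rs)" "a * common_den rs"] by linarith
  moreover have "dsize (Lst (drop k (map enc_rat rs))) \<le> S"
    using S(2) dsize_part_le(1) unfolding enc_rats_def by blast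
  ultimately show "fits S (st [v0,v1,v2,v3,v4,v5,v6,Num (a * common_den (take k rs)),v8,v9,
      Lst (drop k (map enc_rat rs)),v11])"
    using vs by (intro fits_st) (simp_all del: dsize.simps)
next
  fix k assume "k < length (map enc_rat rs)"
  then have "common_den (take (Suc k) rs) = common_den (take k rs) * den (rs ! k)"
    by (simp add: take_Suc_conv_app_nth common_den_append)
  then show "assigned scale_body (st [v0,v1,v2,v3,v4,v5,v6,Num (a * common_den (take k rs)),v8,v9,
      Lst (drop k (map enc_rat rs)),v11]) =
    st [v0,v1,v2,v3,v4,v5,v6,Num (a * common_den (take (Suc k) rs)),v8,v9,
      Lst (drop (Suc k) (map enc_rat rs)),v11]"
    using \<open>k < length (map enc_rat rs)\<close>
    by (simp add: scale_body_def mult.assoc st_apply st_update enc_rat_def)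
qed (simp_all add: st_apply enc_rats_def)

lemma runs_reverse:
  assumes S: "dsize (Lst xs) \<le> S" and vs: "\<forall>v\<in>{v0,v1,v2,v3,v4,v5,v6,v7,v10,v11}. dsize v \<le> S"
  shows "runs (loop 9 reverse_body)
    (st [v0,v1,v2,v3,v4,v5,v6,v7,Lst [],Lst (rev xs),v10,v11]) (loop_time S (load reverse_body * S))
    (st [v0,v1,v2,v3,v4,v5,v6,v7,Lst xs,Lst [],v10,v11])"
proof (rule runs_loop[where xs = "rev xs" and \<sigma> = "\<lambda>k.
    st [v0,v1,v2,v3,v4,v5,v6,v7,Lst (rev (take k (rev xs))),Lst (drop k (rev xs)),v10,v11]"])
  fix k
  have "dsize (Lst (rev xs)) \<le> S" using S by (rule dsize_part_le)
  then have "dsize (Lst (rev (take k (rev xs)))) \<le> S" "dsize (Lst (drop k (rev xs))) \<le> S"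
    using dsize_part_le by blast+
  then show "fits S (st [v0,v1,v2,v3,v4,v5,v6,v7,Lst (rev (take k (rev xs))),
      Lst (drop k (rev xs)),v10,v11])"
    using vs by (intro fits_st) (simp_all del: dsize.simps)
next
  fix k assume "k < length (rev xs)"
  then show "assigned reverse_body (st [v0,v1,v2,v3,v4,v5,v6,v7,Lst (rev (take k (rev xs))),
      Lst (drop k (rev xs)),v10,v11]) =
    st [v0,v1,v2,v3,v4,v5,v6,v7,Lst (rev (take (Suc k) (rev xs))),Lst (drop (Suc k) (rev xs)),v10,v11]"
    by (simp add: reverse_body_def st_apply st_update rev_take_Suc del: length_rev)
qed (simp_all add: st_apply)

section \<open>Size bounds for the register contents\<close>

context historic
begin

text \<open>A cost vector has at most \<open>bits\<close> entries. Three factors below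
  \<open>2 ^ bits\<close> (from \<alpha>, a numerator and the scale) and one more for the number of
  summands give \<open>4 * bits\<close>; the 5 covers sign, list node and denominator, the leading 1
  the outer list.\<close>

definition reg_bound :: nat where
  "reg_bound = 1 + bits * (4 * bits + 5)"

abbreviation "incidence \<equiv> map (\<lambda>j. Num (of_bool (j \<in> important I))) [0..<length (costs I)]"

lemma component_sizes:
  "dsize (descr I) \<le> bits" "dsize (enc_rats (costs I)) \<le> bits"
  "dsize (Lst (map enc_bits (history I))) \<le> bits" "dsize (enc_rats (weights I)) \<le> bits"
  "dsize (enc_rat (alpha I)) \<le> bits" "dsize (Lst incidence) \<le> bits"
  by (simp_all add: enc_historic_def enc_bits_def comp_def)

lemma bits_le_reg_bound: "bits + 1 \<le> reg_bound"
proof -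
  have "bits * 1 \<le> bits * (4 * bits + 5)" by (intro mult_le_mono) auto
  then show ?thesis by (simp add: reg_bound_def)
qed

lemma scale_less: "scale I < 2 ^ bits"
proof -
  have "scale I < 2 ^ dsize (enc_rats (costs I)) * 2 ^ dsize (enc_rats (weights I))"
    unfolding scale_def using common_den_bound one_le_common_den
    by (intro mult_strict_mono) (auto intro: order.trans[OF zero_le_one])
  also have "\<dots> \<le> 2 ^ bits"
    unfolding power_add[symmetric] by (rule power_increasing) (simp_all add: enc_historic_def)
  finally show ?thesis .
qed

lemma num_less: "dsize (enc_rat r) \<le> bits \<Longrightarrow> \<bar>num r\<bar> < 2 ^ bits"
  unfolding floorlog_le_bits[symmetric] by (simp add: enc_rat_def)

lemma den_less: "dsize (enc_rat r) \<le> bits \<Longrightarrow> \<bar>den r\<bar> < 2 ^ bits"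
  unfolding floorlog_le_bits[symmetric] by (simp add: enc_rat_def)

lemma scaled_num_le:
  assumes "\<bar>f\<bar> < 2 ^ bits" "dsize (enc_rat r) \<le> bits"
  shows "\<bar>f * (num r * scale I div den r)\<bar> \<le> 2 ^ (3 * bits)"
proof -
  have "\<bar>f * (num r * scale I div den r)\<bar> \<le> \<bar>f\<bar> * (\<bar>num r\<bar> * \<bar>scale I\<bar>)"
    using abs_div_le[of "num r * scale I" "den r"] by (simp add: abs_mult mult_left_mono)
  also have "\<dots> \<le> 2 ^ bits * (2 ^ bits * 2 ^ bits)"
    using assms num_less[OF assms(2)] scale_less scale_pos by (intro mult_mono) auto
  finally show ?thesis by (simp add: numeral_3_eq_3 power_add)
qed

lemma partial_cost_le:
  assumes "j < length (costs I)" "k \<le> length (history I)"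
  shows "\<bar>partial_cost I k j\<bar> \<le> (int k + 1) * 2 ^ (3 * bits)"
proof -
  have "\<bar>scaled_weight I i * sign_at I i j\<bar> \<le> 2 ^ (3 * bits)" if "i < k" for i
  proof -
    have "dsize (enc_rat (weights I ! i)) \<le> dsize (enc_rats (weights I))"
      unfolding enc_rats_def using that assms length_weights by (intro dsize_le_of_mem) auto
    \<comment> \<open>Since 0 < \<alpha> < 1, the difference lies between 0 and the denominator and
      needs no extra bit.\<close>
    moreover have "\<bar>den (alpha I) - num (alpha I)\<bar> < 2 ^ bits"
      using num_alpha den_less[OF component_sizes(5)] by linarith
    ultimately have "\<bar>scaled_weight I i\<bar> \<le> 2 ^ (3 * bits)"
      unfolding scaled_weight_def using component_sizes(4) by (intro scaled_num_le) auto
    then show ?thesis by (simp add: sign_at_def abs_mult)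
  qed
  then have "\<bar>\<Sum>i<k. scaled_weight I i * sign_at I i j\<bar> \<le> int k * 2 ^ (3 * bits)"
    using order.trans[OF sum_abs sum_bounded_above[of "{..<k}"
      "\<lambda>i. \<bar>scaled_weight I i * sign_at I i j\<bar>" "2 ^ (3 * bits)"]] by simp
  moreover have "dsize (enc_rat (costs I ! j)) \<le> dsize (enc_rats (costs I))"
    unfolding enc_rats_def using assms by (intro dsize_le_of_mem) auto
  then have "\<bar>base_cost I j\<bar> \<le> 2 ^ (3 * bits)"
    unfolding base_cost_def using component_sizes num_less[OF component_sizes(5)]
    by (intro scaled_num_le) auto
  ultimately show ?thesis
    unfolding partial_cost_def using abs_triangle_ineq by (simp add: distrib_right)
qed

lemma reduced_costs_nth:
  "j < length (costs I) \<Longrightarrow>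
    map enc_rat (reduced_costs I k) ! j = Lst [Num (partial_cost I k j), Num 1]"
  by (simp add: reduced_costs_def enc_rat_def)

lemma dsize_reduced_costs:
  assumes "k \<le> length (history I)"
  shows "dsize (enc_rats (reduced_costs I k)) \<le> reg_bound"
proof -
  let ?n = "length (costs I)"
  \<comment> \<open>The extra 1 comes from the outer list node of the encoded instance, which makes
    it strictly larger than the encoded history.\<close>
  have n: "?n \<le> bits" "k + 1 \<le> bits"
    using length_le_dsize[of "map enc_rat (costs I)"] component_sizes(2)
      length_le_dsize[of "map enc_bits (history I)"] assms
    by (auto simp: enc_rats_def enc_historic_def)
  have entry: "dsize (enc_rat (of_int (partial_cost I k j))) \<le> 4 * bits + 5" if "j < ?n" for j
  proof -
    have "int k + 1 < 2 ^ bits"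
      using order.strict_trans1[OF n(2) less_exp] by (simp flip: of_nat_less_iff[where ?'a = int])
    then have "(int k + 1) * 2 ^ (3 * bits) < 2 ^ bits * 2 ^ (3 * bits)"
      by (intro mult_strict_right_mono) auto
    with partial_cost_le[OF that assms] have "\<bar>partial_cost I k j\<bar> < 2 ^ (4 * bits)"
      by (simp flip: power_add)
    then have "floorlog 2 (nat \<bar>partial_cost I k j\<bar>) \<le> 4 * bits"
      by (simp only: floorlog_le_bits)
    moreover have "dsize (Num 1) \<le> 2" using dsize_of_bool_le[of True] by simp
    ultimately show ?thesis by (simp add: enc_rat_def)
  qed
  have "(\<Sum>j\<leftarrow>[0..<?n]. dsize (enc_rat (of_int (partial_cost I k j)))) \<le>
      (\<Sum>j\<leftarrow>[0..<?n]. 4 * bits + 5)"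
    using entry by (intro sum_list_mono) simp
  also have "\<dots> \<le> bits * (4 * bits + 5)"
    using n by (simp add: sum_list_triv)
  finally show ?thesis
    by (simp add: reduced_costs_def enc_rats_def reg_bound_def comp_def)
qed

text \<open>A catalogue of the values stored by the reduction; with \<open>dsize_part_le\<close> for
  remainders and prefixes it lets rewriting settle the \<open>fits\<close> goals.\<close>

lemma reg_sizes:
  "1 \<le> reg_bound" "dsize (Lst []) \<le> reg_bound" "dsize (Num 1) \<le> reg_bound"
  "dsize (enc_historic I) \<le> reg_bound"
  "dsize (descr I) \<le> reg_bound" "dsize (Lst (map enc_rat (costs I))) \<le> reg_bound"
  "dsize (Lst (map enc_bits (history I))) \<le> reg_bound"
  "dsize (Lst (map enc_rat (weights I))) \<le> reg_bound"
  "dsize (enc_rat (alpha I)) \<le> reg_bound" "dsize (Lst incidence) \<le> reg_bound"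
  "dsize (Num (scale I)) \<le> reg_bound" "dsize (Num (common_den (costs I))) \<le> reg_bound"
  "k \<le> length (history I) \<Longrightarrow> dsize (Lst (map enc_rat (reduced_costs I k))) \<le> reg_bound"
  "i < length (history I) \<Longrightarrow> dsize (enc_bits (history I ! i)) \<le> reg_bound"
proof -
  show "1 \<le> reg_bound" "dsize (Lst []) \<le> reg_bound" by (simp_all add: reg_bound_def)
  show "dsize (enc_historic I) \<le> reg_bound" using bits_le_reg_bound by simp
  show "dsize (descr I) \<le> reg_bound" "dsize (Lst (map enc_rat (costs I))) \<le> reg_bound"
    "dsize (Lst (map enc_bits (history I))) \<le> reg_bound"
    "dsize (Lst (map enc_rat (weights I))) \<le> reg_bound"
    "dsize (enc_rat (alpha I)) \<le> reg_bound" "dsize (Lst incidence) \<le> reg_bound"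
    using component_sizes bits_le_reg_bound unfolding enc_rats_def by linarith+
  have "\<bar>scale I\<bar> < 2 ^ bits" using scale_less scale_pos by simp
  then show *: "dsize (Num (scale I)) \<le> reg_bound"
    using bits_le_reg_bound by (simp flip: floorlog_le_bits)
  have "common_den (costs I) * 1 \<le> scale I"
    unfolding scale_def using one_le_common_den[of "costs I"] one_le_common_den[of "weights I"]
    by (intro mult_left_mono) auto
  then show "dsize (Num (common_den (costs I))) \<le> reg_bound"
    using * dsize_Num_mono[of "common_den (costs I)" "scale I"] one_le_common_den[of "costs I"]
    by linarith
  have "1 \<le> bits" by (rule one_le_dsize)
  with bits_le_reg_bound dsize_of_bool_le[of True] show "dsize (Num 1) \<le> reg_bound" by simp
  show "k \<le> length (history I) \<Longrightarrow> dsize (Lst (map enc_rat (reduced_costs I k))) \<le> reg_bound"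
    using dsize_reduced_costs unfolding enc_rats_def .
  show "i < length (history I) \<Longrightarrow> dsize (enc_bits (history I ! i)) \<le> reg_bound"
    using dsize_le_of_mem[of "enc_bits (history I ! i)" "map enc_bits (history I)"]
      component_sizes(3) bits_le_reg_bound by simp
qed

section \<open>Execution of the reduction on an instance\<close>

lemma runs_base:
  assumes "dsize v3 \<le> reg_bound" "dsize v4 \<le> reg_bound" "dsize v6 \<le> reg_bound"
  shows "runs (loop 2 base_body)
    (st [Lst [], descr I, enc_rats (costs I), v3, v4, enc_rat (alpha I), v6, Num (scale I),
      Lst [], Lst [], Lst [], Lst []])
    (loop_time reg_bound (load base_body * reg_bound))
    (st [Lst [], descr I, Lst [], v3, v4, enc_rat (alpha I), v6, Num (scale I),
      Lst [], Lst (rev (map enc_rat (reduced_costs I 0))), Lst [], Lst []])"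
proof (rule runs_loop[where xs = "map enc_rat (costs I)" and \<sigma> = "\<lambda>k.
    st [Lst [], descr I, Lst (drop k (map enc_rat (costs I))), v3, v4, enc_rat (alpha I), v6,
      Num (scale I), Lst [], Lst (rev (take k (map enc_rat (reduced_costs I 0)))), Lst [], Lst []]"])
  fix k
  show "fits reg_bound (st [Lst [], descr I, Lst (drop k (map enc_rat (costs I))), v3, v4,
      enc_rat (alpha I), v6, Num (scale I), Lst [],
      Lst (rev (take k (map enc_rat (reduced_costs I 0)))), Lst [], Lst []])"
    using assms by (intro fits_st) (simp_all add: reg_sizes dsize_part_le del: dsize.simps)
next
  fix k assume "k < length (map enc_rat (costs I))"
  then have k: "k < length (costs I)" by simp
  have "map enc_rat (reduced_costs I 0) ! k =
      Lst [Num (num (alpha I) * (num (costs I ! k) * scale I div den (costs I ! k))), Num 1]"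
    by (simp only: reduced_costs_nth[OF k]) (simp add: partial_cost_def base_cost_def)
  moreover have "k < length (map enc_rat (reduced_costs I 0))"
    using k by (simp add: reduced_costs_def)
  ultimately show "assigned base_body (st [Lst [], descr I, Lst (drop k (map enc_rat (costs I))),
      v3, v4, enc_rat (alpha I), v6, Num (scale I), Lst [],
      Lst (rev (take k (map enc_rat (reduced_costs I 0)))), Lst [], Lst []]) =
    st [Lst [], descr I, Lst (drop (Suc k) (map enc_rat (costs I))), v3, v4, enc_rat (alpha I), v6,
      Num (scale I), Lst [], Lst (rev (take (Suc k) (map enc_rat (reduced_costs I 0)))),
      Lst [], Lst []]"
    using k by (simp only: rev_take_Suc)
      (simp add: base_body_def scale_of_def st_apply st_update enc_rat_def[of "alpha I"]
        enc_rat_def[of "costs I ! k"])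
qed (simp_all add: st_apply enc_rats_def reduced_costs_def)

lemma partial_cost_Suc:
  "partial_cost I (Suc i) j = partial_cost I i j + scaled_weight I i * sign_at I i j"
  by (simp add: partial_cost_def)

text \<open>Cost vector, historic bits and incidence vector are read in lockstep. They have equal
  length, so testing register 8 alone suffices and registers 10 and 11 end empty; the weight stays
  at the head of register 4 throughout.\<close>

lemma runs_update_loop:
  assumes i: "i < length (history I)" and vs: "dsize v3 \<le> reg_bound"
  shows "runs (loop 8 update_body)
    (st [Lst [], descr I, Lst [], v3, Lst (drop i (map enc_rat (weights I))), enc_rat (alpha I),
      Lst incidence, Num (scale I), Lst (map enc_rat (reduced_costs I i)), Lst [],
      enc_bits (history I ! i), Lst incidence])
    (loop_time reg_bound (load update_body * reg_bound))
    (st [Lst [], descr I, Lst [], v3, Lst (drop i (map enc_rat (weights I))), enc_rat (alpha I),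
      Lst incidence, Num (scale I), Lst [], Lst (rev (map enc_rat (reduced_costs I (Suc i)))),
      Lst [], Lst []])"
proof -
  let ?h = "map (\<lambda>b. Num (of_bool b)) (history I ! i)"
  let ?A = "\<lambda>i. map enc_rat (reduced_costs I i)"
  let ?\<sigma> = "\<lambda>k. st [Lst [], descr I, Lst [], v3, Lst (drop i (map enc_rat (weights I))),
    enc_rat (alpha I), Lst incidence, Num (scale I), Lst (drop k (?A i)),
    Lst (rev (take k (?A (Suc i)))), Lst (drop k ?h), Lst (drop k incidence)]"
  have lengths: "length (?A i) = length (costs I)" "length (?A (Suc i)) = length (costs I)"
    "length (history I ! i) = length (costs I)"
    using i length_history by (simp_all add: reduced_costs_def)
  show ?thesis
  proof (rule runs_loop[where xs = "?A i" and \<sigma> = ?\<sigma>])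
    fix k
    show "fits reg_bound (?\<sigma> k)"
      using vs i reg_sizes(14)[OF i, unfolded enc_bits_def]
      by (intro fits_st) (simp_all add: reg_sizes dsize_part_le del: dsize.simps)
  next
    fix k assume "k < length (?A i)"
    then have k: "k < length (costs I)" by (simp only: lengths)
    have entry: "?A (Suc i) ! k = Lst [Num (partial_cost I i k + (den (alpha I) - num (alpha I)) *
        (num (weights I ! i) * scale I div den (weights I ! i)) *
        (of_bool (k \<in> important I) * (1 - 2 * of_bool (history I ! i ! k)))), Num 1]"
      by (simp only: reduced_costs_nth[OF k] partial_cost_Suc scaled_weight_def sign_at_def)
    have "map enc_rat (weights I) ! i = enc_rat (weights I ! i)"
      "?h ! k = Num (of_bool (history I ! i ! k))" "incidence ! k = Num (of_bool (k \<in> important I))"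
      using k i lengths length_weights by simp_all
    then show "assigned update_body (?\<sigma> k) = ?\<sigma> (Suc k)"
      using k i lengths entry reduced_costs_nth[OF k, of i] length_weights
      by (simp only: rev_take_Suc)
        (simp add: update_body_def scale_of_def st_apply st_update enc_rat_def[of "alpha I"]
          enc_rat_def[of "weights I ! i"] del: nth_map)
  qed (use lengths in \<open>simp_all add: st_apply enc_bits_def\<close>)
qed

definition outer_store :: "nat \<Rightarrow> store" where
  "outer_store i = st [Lst [], descr I, Lst [], Lst (drop i (map enc_bits (history I))),
    Lst (drop i (map enc_rat (weights I))), enc_rat (alpha I), Lst incidence, Num (scale I),
    Lst (map enc_rat (reduced_costs I i)), Lst [], Lst [], Lst []]"

lemma fits_outer_store: "i \<le> length (history I) \<Longrightarrow> fits reg_bound (outer_store i)"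
  unfolding outer_store_def
  by (intro fits_st) (simp_all add: reg_sizes dsize_part_le del: dsize.simps)

lemma runs_update_com:
  assumes i: "i < length (history I)"
  shows "runs update_com (outer_store i) (update_time reg_bound) (outer_store (Suc i))"
  unfolding update_com_def update_time_def
proof (intro runs_Seq)
  let ?v3 = "Lst (drop i (map enc_bits (history I)))"
  \<comment> \<open>\<open>?r\<close>, \<open>?s\<close> and \<open>?t\<close> are the stores
    between the four commands of one round.\<close>
  let ?r = "st [Lst [], descr I, Lst [], ?v3, Lst (drop i (map enc_rat (weights I))),
    enc_rat (alpha I), Lst incidence, Num (scale I), Lst (map enc_rat (reduced_costs I i)), Lst [],
    enc_bits (history I ! i), Lst incidence]"
  let ?s = "st [Lst [], descr I, Lst [], ?v3, Lst (drop i (map enc_rat (weights I))),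
    enc_rat (alpha I), Lst incidence, Num (scale I), Lst [],
    Lst (rev (map enc_rat (reduced_costs I (Suc i)))), Lst [], Lst []]"
  let ?t = "st [Lst [], descr I, Lst [], ?v3, Lst (drop i (map enc_rat (weights I))),
    enc_rat (alpha I), Lst incidence, Num (scale I), Lst (map enc_rat (reduced_costs I (Suc i))),
    Lst [], Lst [], Lst []]"
  have v3: "dsize ?v3 \<le> reg_bound" by (simp add: reg_sizes dsize_part_le del: dsize.simps)
  show "runs (assigns prepare_update) (outer_store i) (load prepare_update * reg_bound) ?r"
    using i fits_outer_store[of i]
    by (intro runs_assigns') (simp_all add: outer_store_def prepare_update_def st_apply st_update)
  show "runs (loop 8 update_body) ?r (loop_time reg_bound (load update_body * reg_bound)) ?s"
    using i v3 by (rule runs_update_loop)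
  show "runs (loop 9 reverse_body) ?s (loop_time reg_bound (load reverse_body * reg_bound)) ?t"
    using i v3 by (intro runs_reverse) (simp_all add: reg_sizes dsize_part_le del: dsize.simps)
  have "fits reg_bound ?t"
    using i v3 by (intro fits_st) (simp_all add: reg_sizes dsize_part_le del: dsize.simps)
  then show "runs (assigns finish_update) ?t (load finish_update * reg_bound) (outer_store (Suc i))"
    by (rule runs_assigns') (simp add: outer_store_def finish_update_def st_apply st_update)
qed

text \<open>The final store equals an initial store in all registers, so the assumed algorithm can
  be appended by \<open>Seq\<close>.\<close>

lemma runs_reduction:
  "runs reduction (init_store (enc_historic I)) (reduction_time reg_bound)
    (init_store (enc_nominal (descr I, reduced_costs I (length (history I)))))"
  unfolding reduction_def reduction_time_def
proof (intro runs_Seq)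
  let ?N = "length (history I)" and ?a = "enc_rat (alpha I)" and ?e = "Lst incidence"
  let ?c = "enc_rats (costs I)" and ?h = "Lst (map enc_bits (history I))" and ?w = "enc_rats (weights I)"
  let ?A = "Lst (map enc_rat (reduced_costs I 0))"
  note sizes = reg_sizes reg_sizes(6,8)[folded enc_rats_def] dsize_part_le
  have fits: "fits reg_bound (init_store (enc_historic I))"
    unfolding init_store_eq_st[of _ 0] by (intro fits_st) (simp_all add: sizes del: dsize.simps)
  show "runs (assigns load_input) (init_store (enc_historic I)) (load load_input * reg_bound)
    (st [Lst [], descr I, ?c, ?h, ?w, ?a, ?e, Num 1, Lst [], Lst [], ?c, Lst []])"
    using fits by (rule runs_assigns')
      (simp add: init_store_eq_st[of _ 11] eval_nat_numeral enc_historic_def load_input_def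
        enc_bits_def comp_def st_apply st_update)
  \<comment> \<open>The factor 1 is kept in the final store so that it matches
    \<open>runs_scale\<close> with a = 1.\<close>
  show "runs (loop 10 scale_body)
    (st [Lst [], descr I, ?c, ?h, ?w, ?a, ?e, Num 1, Lst [], Lst [], ?c, Lst []])
    (loop_time reg_bound (load scale_body * reg_bound))
    (st [Lst [], descr I, ?c, ?h, ?w, ?a, ?e, Num (1 * common_den (costs I)), Lst [], Lst [],
      Lst [], Lst []])"
    by (intro runs_scale) (simp_all add: sizes del: dsize.simps)
  show "runs (assigns [(10, Var 4)])
    (st [Lst [], descr I, ?c, ?h, ?w, ?a, ?e, Num (1 * common_den (costs I)), Lst [], Lst [],
      Lst [], Lst []])
    (load [(10, Var 4)] * reg_bound)
    (st [Lst [], descr I, ?c, ?h, ?w, ?a, ?e, Num (common_den (costs I)), Lst [], Lst [], ?w, Lst []])"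
    by (intro runs_assigns' fits_st)
      (simp_all add: sizes st_apply st_update del: dsize.simps)
  show "runs (loop 10 scale_body)
    (st [Lst [], descr I, ?c, ?h, ?w, ?a, ?e, Num (common_den (costs I)), Lst [], Lst [], ?w, Lst []])
    (loop_time reg_bound (load scale_body * reg_bound))
    (st [Lst [], descr I, ?c, ?h, ?w, ?a, ?e, Num (scale I), Lst [], Lst [], Lst [], Lst []])"
    unfolding scale_def
    using one_le_common_den reg_sizes(11)[unfolded scale_def]
    by (intro runs_scale) (simp_all add: sizes del: dsize.simps)
  show "runs (loop 2 base_body)
    (st [Lst [], descr I, ?c, ?h, ?w, ?a, ?e, Num (scale I), Lst [], Lst [], Lst [], Lst []])
    (loop_time reg_bound (load base_body * reg_bound))
    (st [Lst [], descr I, Lst [], ?h, ?w, ?a, ?e, Num (scale I), Lst [],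
      Lst (rev (map enc_rat (reduced_costs I 0))), Lst [], Lst []])"
    by (rule runs_base) (simp_all add: sizes del: dsize.simps)
  show "runs (loop 9 reverse_body)
    (st [Lst [], descr I, Lst [], ?h, ?w, ?a, ?e, Num (scale I), Lst [],
      Lst (rev (map enc_rat (reduced_costs I 0))), Lst [], Lst []])
    (loop_time reg_bound (load reverse_body * reg_bound))
    (st [Lst [], descr I, Lst [], ?h, ?w, ?a, ?e, Num (scale I), ?A, Lst [], Lst [], Lst []])"
    by (intro runs_reverse) (simp_all add: sizes del: dsize.simps)
  have "st [Lst [], descr I, Lst [], ?h, ?w, ?a, ?e, Num (scale I), ?A, Lst [], Lst [], Lst []] =
      outer_store 0"
    by (simp add: outer_store_def enc_rats_def)
  moreover have "runs (while_list 3 update_com) (outer_store 0)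
    (loop_time reg_bound (update_time reg_bound)) (outer_store (length (map enc_bits (history I))))"
    by (rule runs_while_list)
      (simp_all add: fits_outer_store runs_update_com, simp add: outer_store_def st_apply)
  ultimately show "runs (while_list 3 update_com)
    (st [Lst [], descr I, Lst [], ?h, ?w, ?a, ?e, Num (scale I), ?A, Lst [], Lst [], Lst []])
    (loop_time reg_bound (update_time reg_bound)) (outer_store ?N)"
    by simp
  show "runs (assigns store_output) (outer_store ?N) (load store_output * reg_bound)
    (init_store (enc_nominal (descr I, reduced_costs I ?N)))"
    by (rule runs_assigns'[OF fits_outer_store])
      (simp_all add: init_store_eq_st[of _ 11] eval_nat_numeral store_output_def outer_store_def
        enc_nominal_def enc_rats_def st_apply st_update)
qed

text \<open>Three summands, each within the bound: the list node, the description and the cost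
  vector.\<close>

lemma dsize_enc_nominal: "dsize (enc_nominal (descr I, reduced_costs I (length (history I)))) \<le> 3 * reg_bound"
  using reg_sizes(1,5) dsize_reduced_costs[of "length (history I)"] by (simp add: enc_nominal_def)

end


section \<open>Polynomial time bounds\<close>

definition is_poly :: "(nat \<Rightarrow> nat) \<Rightarrow> bool" where
  "is_poly f \<longleftrightarrow> (\<exists>p. \<forall>x. f x = poly p x)"

lemma is_poly_const: "is_poly (\<lambda>x. c)"
  unfolding is_poly_def by (rule exI[of _ "[:c:]"]) simp

lemma is_poly_id: "is_poly (\<lambda>x. x)"
  unfolding is_poly_def by (rule exI[of _ "[:0, 1:]"]) simp

lemma is_poly_add: "is_poly f \<Longrightarrow> is_poly g \<Longrightarrow> is_poly (\<lambda>x. f x + g x)"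
  unfolding is_poly_def by (metis poly_add)

lemma is_poly_mult: "is_poly f \<Longrightarrow> is_poly g \<Longrightarrow> is_poly (\<lambda>x. f x * g x)"
  unfolding is_poly_def by (metis poly_mult)

lemma is_poly_poly: "is_poly f \<Longrightarrow> is_poly (\<lambda>x. poly p (f x))"
  unfolding is_poly_def by (metis poly_pcompose)

lemmas is_poly_intros = is_poly_const is_poly_id is_poly_add is_poly_mult is_poly_poly

text \<open>Coefficients are natural numbers. This allows the time of the assumed algorithm to be
  estimated at a bound on the size of its input.\<close>

lemma poly_nat_mono: "x \<le> y \<Longrightarrow> poly p x \<le> poly p y" for p :: "nat poly"
  by (induction p) (auto intro!: add_mono mult_mono)

theorem theorem3:
  fixes n :: "data \<Rightarrow> nat" and X :: "data \<Rightarrow> bool list set"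
  assumes "\<And>d x. x \<in> X d \<Longrightarrow> length x = n d"
    and "poly_time_solvable enc_nominal enc_bits (nominal_instances n X) (nominal_optima X)"
  shows "poly_time_solvable enc_historic enc_bits (historic_instances n X) (historic_optima X)"
proof -
  obtain c p where nominal: "\<And>i. i \<in> nominal_instances n X \<Longrightarrow> \<exists>t s'. \<exists>y\<in>nominal_optima X i.
      exec c (init_store (enc_nominal i)) t s' \<and> s' 0 = enc_bits y \<and> t \<le> poly p (dsize (enc_nominal i))"
    using assms(2) unfolding poly_time_solvable_def by blast
  \<comment> \<open>\<open>reg_bound\<close> as a function of the input size alone, so that one
    polynomial serves all instances.\<close>
  define S where "S L = 1 + L * (4 * L + 5)" for L :: nat
  have "is_poly (\<lambda>L. reduction_time (S L) + poly p (3 * S L))"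
    unfolding reduction_time_def update_time_def loop_time_def S_def by (intro is_poly_intros)
  then obtain q where q: "\<And>L. reduction_time (S L) + poly p (3 * S L) = poly q L"
    unfolding is_poly_def by blast
  show ?thesis
    unfolding poly_time_solvable_def
  proof (intro exI[of _ "Seq reduction c"] exI[of _ q] ballI)
    fix I assume I: "I \<in> historic_instances n X"
    let ?L = "dsize (enc_historic I)"
    let ?J = "(descr I, reduced_costs I (length (history I)))"
    interpret historic I
      using I assms(1) by unfold_locales (auto simp: historic_instances_def)
    have S: "reg_bound = S ?L" by (simp add: reg_bound_def S_def)
    have len: "length x = length (costs I)" if "x \<in> X (descr I)" for x
      using I that assms(1) by (simp add: historic_instances_def)
    \<comment> \<open>Nominal instances need a feasible solution; any historic solution is
      one.\<close>
    have "X (descr I) \<noteq> {}"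
      using I by (cases "history I") (auto simp: historic_instances_def)
    then have "?J \<in> nominal_instances n X"
      using I by (simp add: nominal_instances_def historic_instances_def reduced_costs_def)
    from nominal[OF this] obtain t s' y where t: "y \<in> nominal_optima X ?J"
      "exec c (init_store (enc_nominal ?J)) t s'" "s' 0 = enc_bits y"
      "t \<le> poly p (dsize (enc_nominal ?J))"
      by blast
    obtain u where u: "u \<le> reduction_time (S ?L)"
      "exec reduction (init_store (enc_historic I)) u (init_store (enc_nominal ?J))"
      using runs_reduction unfolding runs_def S by blast
    have "u + t \<le> poly q ?L"
      using u(1) t(4) poly_nat_mono[OF dsize_enc_nominal, of p] q[of ?L] unfolding S by linarith
    moreover have "y \<in> historic_optima X I"
      using t(1) is_arg_min_reduced[OF len] by (simp add: nominal_optima_def historic_optima_def)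
    ultimately show "\<exists>t s'. \<exists>y\<in>historic_optima X I.
        exec (Seq reduction c) (init_store (enc_historic I)) t s' \<and> s' 0 = enc_bits y \<and> t \<le> poly q ?L"
      using exec.Seq[OF u(2) t(2)] t(3) by blast
  qed
qed

end
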